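(* Let $K$ be a field of characteristic zero, $S=K[X_1,\dots,X_n]$, let $(A,C,\rho)$ be a good binomial system of degree $d$ in $n$ indeterminates and let $\tau$ be an admissible term order. Let $F(A,C,\rho)\subset S$ be the ideal generated by $\{X^a\mid a\in A\}\cup\{X^c-X^{c+\rho}\mid c\in C\}$. Then $$\mathrm{Gin}_\tau F(A,C,\rho)=\mathrm{in}_\tau F(A,C,\rho).$$
   Context: $n,d\geq1$ are integers; $\mathbb{N}$ is the set of nonnegative integers; $e_1,\dots,e_n$ are the standard vectors. For $a\in\mathbb{Z}^n$: $|a|=\sum_i a_i$, $m(a)=\max(\{1\leq i\leq n\mid a_i\neq0\}\cup\{1\})$, $X^a=X_1^{a_1}\cdots X_n^{a_n}$. $\mathbb{N}^n_d=\{c\in\mathbb{N}^n\mid |c|=d\}$. Borel order on $\mathbb{N}^n_d$: $a\geq_{\mathrm{Bor}}b$ iff there are $\alpha_1,\dots,\alpha_{n-1}\in\mathbb{N}$ with $a-b=\sum_{j=1}^{n-1}\alpha_j(e_j-e_{j+1})$. A set $B\subset\mathbb{N}^n_d$ is a Borel set if $a\in B$, $b\in\mathbb{N}^n_d$, $b\geq_{\mathrm{Bor}}a$ imply $b\in B$. A binomial system (of degree $d$ in $n$ indeterminates) is a triple $(A,C,\rho)$ with $A,C\subset\mathbb{N}^n_d$, $\rho\in\mathbb{Z}^n$ such that (i) $C+\rho\subset\mathbb{N}^n_d$; (ii) $A\cap C=A\cap(C+\rho)=C\cap(C+\rho)=\emptyset$; (iii) $A\cup C$ and $A\cup(C+\rho)$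 are Borel sets. It is admissible if $C=\emptyset$ or $\rho_{m(\rho)}>0$. It is good if it is admissible and $b_i=c_i$ for all $1\leq i<m(\rho)$ and all $b,c\in C$. A term order is a total order on $\mathbb{N}^n$ (equivalently on monomials, via $X^a\leftrightarrow a$) with $0\leq a$ for all $a$ and $a<b\Rightarrow a+c<b+c$; it is admissible if moreover $e_1>\dots>e_n$ and $|a|>|b|\Rightarrow a>b$. $\mathrm{in}_\tau\mathfrak{a}$ is the ideal generated by the $\tau$-largest monomials (leading monomials) of the nonzero elements of $\mathfrak{a}$. A matrix $g\in \mathrm{Gl}(n,K)$ acts on $S$ by the $K$-algebra map $X_j\mapsto\sum_i g_{ij}X_i$. For a homogeneous ideal $\mathfrak{a}$, $\mathrm{Gin}_\tau\mathfrak{a}$ is the unique ideal equal to $\mathrm{in}_\tau g(\mathfrak{a})$ for all $g$ in some nonempty Zariski open subset of $\mathrm{Gl}(n,K)$. *)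

theory Defs
  imports "HOL-Analysis.Determinants" "HOL-Library.Poly_Mapping"
begin

text \<open>
  The index set 1, ..., n is rendered as a type \<open>'n\<close> of class \<open>{finite, linorder}\<close>, with
  n = CARD('n): the smallest element \<open>Min UNIV\<close> is the index 1 and the largest element
  \<open>Max UNIV\<close> is the index n.  Then S = K[X_1, ..., X_n] is the whole type
  \<open>('n, 'k) mpoly\<close>, whose ring structure is that of Poly_Mapping.
\<close>

type_synonym 'n expo = "'n \<Rightarrow>\<^sub>0 nat"
type_synonym ('n, 'k) mpoly = "('n \<Rightarrow>\<^sub>0 nat) \<Rightarrow>\<^sub>0 'k"

definition unit_expo :: "'n \<Rightarrow> 'n expo"
  where "unit_expo i = Poly_Mapping.single i 1"

definition ivec :: "'n expo \<Rightarrow> 'n \<Rightarrow>\<^sub>0 int"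
  where "ivec a = Poly_Mapping.map int a"

definition total_deg :: "'n::finite expo \<Rightarrow> nat"
  where "total_deg a = (\<Sum>i\<in>UNIV. Poly_Mapping.lookup a i)"

definition expos :: "nat \<Rightarrow> 'n::finite expo set"
  where "expos d = {c. total_deg c = d}"

definition max_index :: "('n::{finite,linorder} \<Rightarrow>\<^sub>0 int) \<Rightarrow> 'n"
  where "max_index a = Max ({i. Poly_Mapping.lookup a i \<noteq> 0} \<union> {Min UNIV})"

subsection \<open>Borel sets and binomial systems\<close>

text \<open>The successor j + 1 of an index j; only used for \<open>j \<noteq> Max UNIV\<close>.\<close>
definition next_index :: "'n::{finite,linorder} \<Rightarrow> 'n"
  where "next_index j = Min {k. j < k}"

definition borel_ge :: "'n::{finite,linorder} expo \<Rightarrow> 'n expo \<Rightarrow> bool"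
  where "borel_ge a b \<longleftrightarrow> (\<exists>\<alpha> :: 'n \<Rightarrow> nat. ivec a - ivec b =
    (\<Sum>j\<in>UNIV - {Max UNIV}. Poly_Mapping.single j (int (\<alpha> j))
                            - Poly_Mapping.single (next_index j) (int (\<alpha> j))))"

definition borel_set :: "nat \<Rightarrow> 'n::{finite,linorder} expo set \<Rightarrow> bool"
  where "borel_set d B \<longleftrightarrow> B \<subseteq> expos d \<and>
    (\<forall>a b. a \<in> B \<longrightarrow> b \<in> expos d \<longrightarrow> borel_ge b a \<longrightarrow> b \<in> B)"

text \<open>
  The part of \<open>C + \<rho>\<close> lying in \<open>\<nat>\<^sup>n\<close>; it is all of \<open>C + \<rho>\<close>
  under the first condition of a binomial system.
\<close>
definition translate :: "('n \<Rightarrow>\<^sub>0 int) \<Rightarrow> 'n expo set \<Rightarrow> 'n expo set"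
  where "translate \<rho> C = {b. \<exists>c\<in>C. ivec b = ivec c + \<rho>}"

definition binomial_system ::
    "nat \<Rightarrow> 'n::{finite,linorder} expo set \<Rightarrow> 'n expo set \<Rightarrow> ('n \<Rightarrow>\<^sub>0 int) \<Rightarrow> bool"
  where "binomial_system d A C \<rho> \<longleftrightarrow>
    A \<subseteq> expos d \<and> C \<subseteq> expos d \<and>
    (\<lambda>c. ivec c + \<rho>) ` C \<subseteq> ivec ` expos d \<and>
    A \<inter> C = {} \<and> A \<inter> translate \<rho> C = {} \<and> C \<inter> translate \<rho> C = {} \<and>
    borel_set d (A \<union> C) \<and> borel_set d (A \<union> translate \<rho> C)"

definition admissible_binomial_system ::
    "nat \<Rightarrow> 'n::{finite,linorder} expo set \<Rightarrow> 'n expo set \<Rightarrow> ('n \<Rightarrow>\<^sub>0 int) \<Rightarrow> bool"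
  where "admissible_binomial_system d A C \<rho> \<longleftrightarrow> binomial_system d A C \<rho> \<and>
    (C = {} \<or> Poly_Mapping.lookup \<rho> (max_index \<rho>) > 0)"

definition good_binomial_system ::
    "nat \<Rightarrow> 'n::{finite,linorder} expo set \<Rightarrow> 'n expo set \<Rightarrow> ('n \<Rightarrow>\<^sub>0 int) \<Rightarrow> bool"
  where "good_binomial_system d A C \<rho> \<longleftrightarrow> admissible_binomial_system d A C \<rho> \<and>
    (\<forall>b\<in>C. \<forall>c\<in>C. \<forall>i<max_index \<rho>. Poly_Mapping.lookup b i = Poly_Mapping.lookup c i)"

subsection \<open>Polynomials and ideals\<close>

definition monomial :: "'n expo \<Rightarrow> ('n, 'k::comm_ring_1) mpoly"
  where "monomial a = Poly_Mapping.single a 1"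

definition const_poly :: "'k \<Rightarrow> ('n, 'k::comm_ring_1) mpoly"
  where "const_poly x = Poly_Mapping.single 0 x"

text \<open>Ideals of a commutative ring are its submodules as a module over itself.\<close>
definition ideal_gen :: "'r::comm_ring_1 set \<Rightarrow> 'r set"
  where "ideal_gen G = module.span (*) G"

definition binomial_ideal ::
    "'n expo set \<Rightarrow> 'n expo set \<Rightarrow> ('n \<Rightarrow>\<^sub>0 int) \<Rightarrow> ('n, 'k::comm_ring_1) mpoly set"
  where "binomial_ideal A C \<rho> = ideal_gen
    (monomial ` A \<union> {monomial c - monomial b |c b. c \<in> C \<and> ivec b = ivec c + \<rho>})"

text \<open>
  The value of a polynomial at the point \<open>\<phi>\<close> of a ring into which the coefficients are mapped
  by \<open>h\<close>.
\<close>
definition eval_poly ::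
    "('k \<Rightarrow> 'r) \<Rightarrow> ('v \<Rightarrow> 'r) \<Rightarrow> ('v::finite, 'k::zero) mpoly \<Rightarrow> 'r::comm_ring_1"
  where "eval_poly h \<phi> f = (\<Sum>m\<in>Poly_Mapping.keys f.
    h (Poly_Mapping.lookup f m) * (\<Prod>i\<in>UNIV. \<phi> i ^ Poly_Mapping.lookup m i))"

subsection \<open>Term orders and initial ideals\<close>

text \<open>A term order is given by its reflexive relation: \<open>(a, b) \<in> \<tau>\<close> means that
  \<open>a \<le> b\<close>, and \<open>(a, b) \<in> \<tau> - Id\<close> that \<open>a < b\<close>.\<close>

definition term_order :: "'n expo rel \<Rightarrow> bool"
  where "term_order \<tau> \<longleftrightarrow> linear_order \<tau> \<and> (\<forall>a. (0, a) \<in> \<tau>) \<and>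
    (\<forall>a b c. (a, b) \<in> \<tau> - Id \<longrightarrow> (a + c, b + c) \<in> \<tau> - Id)"

definition admissible_term_order :: "'n::{finite,linorder} expo rel \<Rightarrow> bool"
  where "admissible_term_order \<tau> \<longleftrightarrow> term_order \<tau> \<and>
    (\<forall>i j. i < j \<longrightarrow> (unit_expo j, unit_expo i) \<in> \<tau> - Id) \<and>
    (\<forall>a b. total_deg a > total_deg b \<longrightarrow> (b, a) \<in> \<tau> - Id)"

definition lead_expo :: "'n expo rel \<Rightarrow> ('n, 'k::zero) mpoly \<Rightarrow> 'n expo"
  where "lead_expo \<tau> f =
    (THE m. m \<in> Poly_Mapping.keys f \<and> (\<forall>m'\<in>Poly_Mapping.keys f. (m', m) \<in> \<tau>))"

definition initial_ideal ::
    "'n expo rel \<Rightarrow> ('n, 'k::comm_ring_1) mpoly set \<Rightarrow> ('n, 'k) mpoly set"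
  where "initial_ideal \<tau> \<aa> = ideal_gen {monomial (lead_expo \<tau> f) |f. f \<in> \<aa> \<and> f \<noteq> 0}"

subsection \<open>Generic initial ideals\<close>

definition GL :: "('k::field ^ 'n ^ 'n) set"
  where "GL = {g. invertible g}"

text \<open>In \<open>g $ i $ j\<close> the row index comes first, so \<open>X\<^sub>j\<close> is mapped by column j of g.\<close>
definition gl_act :: "'k::field ^ 'n ^ 'n \<Rightarrow> ('n::finite, 'k) mpoly \<Rightarrow> ('n, 'k) mpoly"
  where "gl_act g =
    eval_poly const_poly (\<lambda>j. \<Sum>i\<in>UNIV. const_poly (g $ i $ j) * monomial (unit_expo i))"

text \<open>Zariski open subsets of GL: complements in GL of the zero sets of families P of
  polynomials in the matrix entries.\<close>
definition zariski_open_GL :: "('k::field ^ 'n ^ 'n::finite) set \<Rightarrow> bool"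
  where "zariski_open_GL U \<longleftrightarrow> (\<exists>P :: ('n \<times> 'n, 'k) mpoly set.
    U = {g \<in> GL. \<exists>p\<in>P. eval_poly id (\<lambda>(i, j). g $ i $ j) p \<noteq> 0})"

definition Gin ::
    "'n expo rel \<Rightarrow> ('n::finite, 'k::field) mpoly set \<Rightarrow> ('n, 'k) mpoly set"
  where "Gin \<tau> \<aa> = (THE J. \<exists>U. zariski_open_GL U \<and> U \<noteq> {} \<and>
    (\<forall>g\<in>U. initial_ideal \<tau> (gl_act g ` \<aa>) = J))"

end

theory Submission
  imports Defs "HOL-Computational_Algebra.Polynomial"
begin

text \<open>
  Write F for the binomial ideal.  Each matrix g whose leading principal minors do not vanish satisfies
  g V = L for an upper triangular V with diagonal entries 1 and a lower triangular L with nonzero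
  diagonal entries (\<open>exists_upper_unipotent\<close>).  If V(F) = F, then g(F) = g(V(F)) = L(F), and L does not
  change any leading exponent: L sends \<open>X\<^sub>j\<close> to a nonzero multiple of \<open>X\<^sub>j\<close> plus a combination of
  the smaller variables \<open>X\<^sub>i\<close>, i > j (\<open>initial_ideal_gl_act_lower\<close>).  Hence the initial ideals of g(F)
  and F agree for all g in this open set, which contains the identity matrix.

  The heart of the matter is V(F) = F (\<open>gl_act_transvection_generator\<close>).  It suffices to consider the substitutions that replace
  one variable \<open>X\<^sub>k\<close> by \<open>X\<^sub>k + s X\<^sub>j\<close> with j < k.  Such a substitution turns a monomial \<open>X\<^sup>c\<close>
  into a combination of monomials whose exponents arise from c by moving i units from position k
  to position j, with coefficients \<open>binom(c\<^sub>k, i) s\<^sup>i\<close>.  These exponents are larger than c in the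
  Borel order, so they remain in any Borel set that contains c.  Let m be the last position at which
  \<open>\<rho>\<close> does not vanish.

  \<^item> An exponent in A moves within A \<open>\<union>\<close> C and within A \<open>\<union>\<close> (C + \<open>\<rho>\<close>), hence
    within A, because C and C + \<open>\<rho>\<close> are disjoint.
  \<^item> For k > m the exponents c and c + \<open>\<rho>\<close> agree at k, so the images of \<open>X\<^sup>c\<close> and of
    \<open>X\<^bsup>c+\<rho>\<^esup>\<close> have the same coefficients.  Corresponding exponents differ by \<open>\<rho>\<close>, and by
    disjointness either both lie in A or they are c' and c' + \<open>\<rho>\<close> with c' in C.
  \<^item> For \<open>k \<le> m\<close> we have j < m, and all elements of C have the same entry at j because the
    system is good.  A proper move changes that entry, so it leads from C, and likewise from
    C + \<open>\<rho>\<close>, into A.  Modulo F both monomials are fixed.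

  Uniqueness of the generic value is the fact that two nonempty open sets of matrices meet
  (\<open>nonzeros_intersect\<close>): on the
  line through a point of each, the two polynomials that cut out the complements restrict to
  nonzero polynomials in one variable, which have a common nonroot over an infinite field.
\<close>

section \<open>Evaluation of polynomials\<close>

abbreviation lkp :: "('a \<Rightarrow>\<^sub>0 'b::zero) \<Rightarrow> 'a \<Rightarrow> 'b"
  where "lkp \<equiv> Poly_Mapping.lookup"

definition ring_map :: "('r::comm_ring_1 \<Rightarrow> 's::comm_ring_1) \<Rightarrow> bool"
  where "ring_map h \<longleftrightarrow> h 1 = 1 \<and> (\<forall>x y. h (x + y) = h x + h y) \<and> (\<forall>x y. h (x * y) = h x * h y)"

lemma ring_mapD:
  assumes "ring_map h"
  shows "h 0 = 0" "h 1 = 1" "h (x + y) = h x + h y" "h (x * y) = h x * h y"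
    "h (x - y) = h x - h y" "h (x ^ k) = h x ^ k" "h (sum f A) = (\<Sum>i\<in>A. h (f i))"
    "h (prod f A) = (\<Prod>i\<in>A. h (f i))"
proof -
  have add: "h (x + y) = h x + h y" and mult: "h (x * y) = h x * h y" and one: "h 1 = 1" for x y
    using assms by (auto simp: ring_map_def)
  have zero: "h 0 = 0" using add[of 0 0] by simp
  show "h 0 = 0" "h 1 = 1" "h (x + y) = h x + h y" "h (x * y) = h x * h y"
    by (fact zero one add mult)+
  show "h (x - y) = h x - h y" using add[of "x - y" y] by simp
  show "h (x ^ k) = h x ^ k" by (induction k) (simp_all add: one mult)
  show "h (sum f A) = (\<Sum>i\<in>A. h (f i))"
    by (induction A rule: infinite_finite_induct) (simp_all add: zero add)
  show "h (prod f A) = (\<Prod>i\<in>A. h (f i))"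
    by (induction A rule: infinite_finite_induct) (simp_all add: one mult)
qed

lemma ring_map_id: "ring_map id"
  by (simp add: ring_map_def)

lemma ring_map_const_poly: "ring_map const_poly"
  by (simp add: ring_map_def const_poly_def single_add mult_single)

lemma sum_single_lookup: "(\<Sum>m\<in>Poly_Mapping.keys f. Poly_Mapping.single m (lkp f m)) = f"
proof (rule poly_mapping_eqI)
  fix k
  have "lkp (\<Sum>m\<in>Poly_Mapping.keys f. Poly_Mapping.single m (lkp f m)) k
      = (\<Sum>m\<in>Poly_Mapping.keys f. if m = k then lkp f m else 0)"
    unfolding lookup_sum by (intro sum.cong refl) (auto simp: lookup_single when_def)
  then show "lkp (\<Sum>m\<in>Poly_Mapping.keys f. Poly_Mapping.single m (lkp f m)) k = lkp f k"
    by (simp add: in_keys_iff)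
qed

lemma in_keys_sumE:
  assumes "b \<in> Poly_Mapping.keys (sum f A)"
  obtains i where "i \<in> A" "b \<in> Poly_Mapping.keys (f i)"
proof -
  have "\<exists>i\<in>A. b \<in> Poly_Mapping.keys (f i)"
  proof (rule ccontr)
    assume "\<not> ?thesis"
    then have "lkp (sum f A) b = 0"
      unfolding lookup_sum by (intro sum.neutral) (auto simp: in_keys_iff)
    with assms show False by (simp add: in_keys_iff)
  qed
  then show ?thesis using that by blast
qed

lemma single_eq_const_mult_monomial: "Poly_Mapping.single m c = const_poly c * monomial m"
  by (simp add: const_poly_def monomial_def mult_single)

lemma monomial_add: "monomial (a + b) = monomial a * monomial b"
  by (simp add: monomial_def mult_single)

lemma monomial_zero: "monomial 0 = 1"
  by (simp add: monomial_def)

lemma monomial_sum: "monomial (sum f A) = (\<Prod>i\<in>A. monomial (f i))"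
  by (induction A rule: infinite_finite_induct) (simp_all add: monomial_zero monomial_add)

lemma monomial_power: "monomial (unit_expo i) ^ k = monomial (Poly_Mapping.single i k)"
  by (induction k) (simp_all add: monomial_zero unit_expo_def flip: monomial_add single_add)

lemma sum_single_expo:
  fixes m :: "'v::finite \<Rightarrow>\<^sub>0 nat"
  shows "(\<Sum>i\<in>UNIV. Poly_Mapping.single i (lkp m i)) = m"
proof -
  have "(\<Sum>i\<in>UNIV. Poly_Mapping.single i (lkp m i))
      = (\<Sum>i\<in>Poly_Mapping.keys m. Poly_Mapping.single i (lkp m i))"
    by (intro sum.mono_neutral_right) (auto simp: in_keys_iff)
  then show ?thesis by (simp add: sum_single_lookup)
qed

lemma prod_monomial_unit_expo:
  fixes m :: "'v::finite \<Rightarrow>\<^sub>0 nat"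
  shows "(\<Prod>i\<in>UNIV. monomial (unit_expo i) ^ lkp m i) = monomial m"
  by (simp add: monomial_power sum_single_expo flip: monomial_sum)

lemma eval_poly_superset:
  assumes "ring_map h" "finite M" "Poly_Mapping.keys f \<subseteq> M"
  shows "eval_poly h \<phi> f = (\<Sum>m\<in>M. h (lkp f m) * (\<Prod>i\<in>UNIV. \<phi> i ^ lkp m i))"
  unfolding eval_poly_def using assms
  by (intro sum.mono_neutral_left) (auto simp: in_keys_iff ring_mapD)

lemma eval_poly_add:
  assumes "ring_map h"
  shows "eval_poly h \<phi> (f + g) = eval_poly h \<phi> f + eval_poly h \<phi> g"
proof -
  let ?M = "Poly_Mapping.keys f \<union> Poly_Mapping.keys g"
  have "eval_poly h \<phi> p = (\<Sum>m\<in>?M. h (lkp p m) * (\<Prod>i\<in>UNIV. \<phi> i ^ lkp m i))"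
    if "p \<in> {f, g, f + g}" for p
    using that keys_add[of f g] by (intro eval_poly_superset assms) auto
  then show ?thesis
    by (simp add: lookup_add ring_mapD[OF assms] algebra_simps sum.distrib)
qed

lemma eval_poly_zero [simp]: "eval_poly h \<phi> 0 = 0"
  by (simp add: eval_poly_def)

lemma eval_poly_sum:
  assumes "ring_map h"
  shows "eval_poly h \<phi> (sum f A) = (\<Sum>i\<in>A. eval_poly h \<phi> (f i))"
  by (induction A rule: infinite_finite_induct) (simp_all add: eval_poly_add[OF assms])

lemma eval_poly_single:
  assumes "ring_map h"
  shows "eval_poly h \<phi> (Poly_Mapping.single m c) = h c * (\<Prod>i\<in>UNIV. \<phi> i ^ lkp m i)"
  using eval_poly_superset[OF assms, of "{m}" "Poly_Mapping.single m c"] by auto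

lemma eval_poly_single_mult_single:
  assumes "ring_map h"
  shows "eval_poly h \<phi> (Poly_Mapping.single m c * Poly_Mapping.single m' c')
    = eval_poly h \<phi> (Poly_Mapping.single m c) * eval_poly h \<phi> (Poly_Mapping.single m' c')"
  by (simp add: mult_single eval_poly_single[OF assms] lookup_add power_add prod.distrib
      ring_mapD[OF assms] ac_simps)

lemma eval_poly_mult:
  assumes "ring_map h"
  shows "eval_poly h \<phi> (f * g) = eval_poly h \<phi> f * eval_poly h \<phi> g"
proof -
  let ?s = "\<lambda>p m. Poly_Mapping.single m (lkp p m)"
  have "eval_poly h \<phi> ((\<Sum>m\<in>Poly_Mapping.keys f. ?s f m) * (\<Sum>m\<in>Poly_Mapping.keys g. ?s g m))
      = eval_poly h \<phi> (\<Sum>m\<in>Poly_Mapping.keys f. ?s f m) * eval_poly h \<phi> (\<Sum>m\<in>Poly_Mapping.keys g. ?s g m)"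
    unfolding sum_product
    by (simp add: eval_poly_sum[OF assms] eval_poly_single_mult_single[OF assms] sum_product)
  then show ?thesis by (simp add: sum_single_lookup)
qed

lemma ring_map_eval_poly:
  assumes "ring_map h"
  shows "ring_map (eval_poly h \<phi>)"
  using eval_poly_single[OF assms, of \<phi> 0 1]
  by (simp add: ring_map_def eval_poly_add[OF assms] eval_poly_mult[OF assms]) (simp add: ring_mapD[OF assms])

lemma eval_poly_monomial:
  assumes "ring_map h"
  shows "eval_poly h \<phi> (monomial m) = (\<Prod>i\<in>UNIV. \<phi> i ^ lkp m i)"
  by (simp add: monomial_def eval_poly_single[OF assms] ring_mapD[OF assms])

lemma eval_poly_const_poly:
  assumes "ring_map h"
  shows "eval_poly h \<phi> (const_poly c) = h c"
  by (simp add: const_poly_def eval_poly_single[OF assms])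

lemma eval_poly_unit_expo:
  assumes "ring_map h"
  shows "eval_poly h \<phi> (monomial (unit_expo i)) = \<phi> i"
proof -
  have "(\<Prod>j\<in>UNIV. \<phi> j ^ lkp (unit_expo i) j) = (\<Prod>j\<in>UNIV. if j = i then \<phi> i else 1)"
    by (intro prod.cong refl) (auto simp: unit_expo_def lookup_single when_def)
  then show ?thesis by (simp add: eval_poly_monomial[OF assms])
qed

lemma ring_map_eval_poly_comp:
  assumes "ring_map h"
  shows "h (eval_poly k \<phi> f) = eval_poly (h \<circ> k) (h \<circ> \<phi>) f"
  unfolding eval_poly_def by (simp add: ring_mapD[OF assms])

section \<open>The action of matrices\<close>

abbreviation linear_form :: "'k::field ^ 'n ^ 'n \<Rightarrow> 'n \<Rightarrow> ('n::finite, 'k) mpoly"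
  where "linear_form g j \<equiv> \<Sum>i\<in>UNIV. const_poly (g $ i $ j) * monomial (unit_expo i)"

lemma ring_map_gl_act: "ring_map (gl_act g)"
  unfolding gl_act_def by (intro ring_map_eval_poly ring_map_const_poly)

lemmas gl_act_simps = ring_mapD[OF ring_map_gl_act]

lemma gl_act_const_poly: "gl_act g (const_poly c) = const_poly c"
  by (simp add: gl_act_def eval_poly_const_poly ring_map_const_poly)

lemma gl_act_unit_expo: "gl_act g (monomial (unit_expo j)) = linear_form g j"
  by (simp add: gl_act_def eval_poly_unit_expo ring_map_const_poly)

lemma gl_act_monomial: "gl_act g (monomial m) = (\<Prod>j\<in>UNIV. linear_form g j ^ lkp m j)"
  by (simp add: gl_act_def eval_poly_monomial ring_map_const_poly)

lemma gl_act_gl_act: "gl_act g (gl_act h f) = gl_act (g ** h) f"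
proof -
  have "gl_act g (linear_form h j) = linear_form (g ** h) j" for j
  proof -
    have "gl_act g (linear_form h j)
        = (\<Sum>i\<in>UNIV. \<Sum>k\<in>UNIV. const_poly (g $ k $ i * h $ i $ j) * monomial (unit_expo k))"
      by (simp add: gl_act_simps gl_act_const_poly gl_act_unit_expo sum_distrib_left
          ring_mapD[OF ring_map_const_poly] ac_simps)
    also have "\<dots> = linear_form (g ** h) j"
      by (subst sum.swap)
        (simp add: matrix_matrix_mult_def ring_mapD[OF ring_map_const_poly] sum_distrib_right)
    finally show ?thesis .
  qed
  then have "gl_act g \<circ> linear_form h = linear_form (g ** h)"
    by (auto simp: fun_eq_iff)
  moreover have "gl_act g \<circ> const_poly = const_poly"
    by (auto simp: fun_eq_iff gl_act_const_poly)
  ultimately show ?thesis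
    using ring_map_eval_poly_comp[OF ring_map_gl_act[of g], of const_poly "linear_form h" f]
    by (simp add: gl_act_def[of h] gl_act_def[of "g ** h"])
qed

lemma gl_act_mat_1:
  fixes f :: "('n::finite, 'k::field) mpoly"
  shows "gl_act (mat 1) f = f"
proof -
  have "linear_form (mat 1) j = monomial (unit_expo j)" for j :: "'n::finite"
  proof -
    have "linear_form (mat 1) j = (\<Sum>i\<in>UNIV. if i = j then monomial (unit_expo j) else 0)"
      by (intro sum.cong refl) (auto simp: mat_def ring_mapD[OF ring_map_const_poly])
    then show ?thesis by simp
  qed
  then have "linear_form (mat 1 :: 'k ^ 'n ^ 'n) = (\<lambda>j. monomial (unit_expo j))"
    by (rule ext)
  then have "gl_act (mat 1) f = eval_poly const_poly (\<lambda>j. monomial (unit_expo j)) f"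
    by (simp only: gl_act_def)
  then show ?thesis
    by (simp add: eval_poly_def prod_monomial_unit_expo sum_single_lookup
        flip: single_eq_const_mult_monomial)
qed

section \<open>Leading exponents\<close>

text \<open>
  The zero polynomial has no leading exponent in this sense, so a proof that \<open>p\<close> leads with \<open>a\<close>
  also shows that \<open>p\<close> is not zero, which the value of \<open>lead_expo\<close> alone does not.
\<close>
definition has_lead :: "'n expo rel \<Rightarrow> ('n, 'k::zero) mpoly \<Rightarrow> 'n expo \<Rightarrow> bool"
  where "has_lead \<tau> p a \<longleftrightarrow> lkp p a \<noteq> 0 \<and> (\<forall>b\<in>Poly_Mapping.keys p. (b, a) \<in> \<tau>)"

lemma has_lead_lead_expo:
  assumes "term_order \<tau>" "has_lead \<tau> p a"
  shows "lead_expo \<tau> p = a"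
  unfolding lead_expo_def
proof (rule the_equality)
  show "a \<in> Poly_Mapping.keys p \<and> (\<forall>m'\<in>Poly_Mapping.keys p. (m', a) \<in> \<tau>)"
    using assms(2) by (auto simp: has_lead_def in_keys_iff)
  have "antisym \<tau>"
    using assms(1) by (auto simp: term_order_def linear_order_on_def partial_order_on_def)
  then show "m = a" if "m \<in> Poly_Mapping.keys p \<and> (\<forall>m'\<in>Poly_Mapping.keys p. (m', m) \<in> \<tau>)" for m
    using that assms(2) by (auto simp: has_lead_def in_keys_iff antisym_def)
qed

lemma term_order_props:
  assumes "term_order \<tau>"
  shows "(a, a) \<in> \<tau>" "(a, b) \<in> \<tau> \<Longrightarrow> (b, c) \<in> \<tau> \<Longrightarrow> (a, c) \<in> \<tau>"
    "(a, b) \<in> \<tau> \<Longrightarrow> (b, a) \<in> \<tau> \<Longrightarrow> a = b" "(a, b) \<in> \<tau> \<or> (b, a) \<in> \<tau>"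
    "(a, b) \<in> \<tau> \<Longrightarrow> (a + c, b + c) \<in> \<tau>"
proof -
  have \<tau>: "refl \<tau>" "trans \<tau>" "antisym \<tau>" "total \<tau>"
    using assms by (auto simp: term_order_def linear_order_on_def partial_order_on_def preorder_on_def)
  show refl: "(a, a) \<in> \<tau>" for a using \<tau>(1) by (auto simp: refl_on_def)
  show "(a, b) \<in> \<tau> \<Longrightarrow> (b, c) \<in> \<tau> \<Longrightarrow> (a, c) \<in> \<tau>" using \<tau>(2) by (rule transD)
  show "(a, b) \<in> \<tau> \<Longrightarrow> (b, a) \<in> \<tau> \<Longrightarrow> a = b" using \<tau>(3) by (rule antisymD)
  show "(a, b) \<in> \<tau> \<or> (b, a) \<in> \<tau>" using \<tau>(4) refl by (cases "a = b") (auto simp: total_on_def)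
  show "(a, b) \<in> \<tau> \<Longrightarrow> (a + c, b + c) \<in> \<tau>"
    using assms refl by (cases "a = b") (auto simp: term_order_def)
qed

lemma finite_has_greatest:
  assumes "term_order \<tau>" "finite M" "M \<noteq> {}"
  shows "\<exists>a\<in>M. \<forall>b\<in>M. (b, a) \<in> \<tau>"
  using assms(2,3)
proof (induction M rule: finite_ne_induct)
  case (singleton x)
  then show ?case using term_order_props[OF assms(1)] by auto
next
  case (insert x M)
  then show ?case using term_order_props[OF assms(1)] by (metis insert_iff)
qed

lemma has_lead_exists:
  assumes "term_order \<tau>" "p \<noteq> 0"
  shows "\<exists>a. has_lead \<tau> p a"
  using finite_has_greatest[OF assms(1), of "Poly_Mapping.keys p"] assms(2)
  by (auto simp: has_lead_def in_keys_iff)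

lemma has_lead_single:
  assumes "term_order \<tau>" "c \<noteq> 0"
  shows "has_lead \<tau> (Poly_Mapping.single a c) a"
  using assms(2) term_order_props[OF assms(1)] by (auto simp: has_lead_def)

lemma has_lead_one:
  assumes "term_order \<tau>"
  shows "has_lead \<tau> (1 :: ('n, 'k::field) mpoly) 0"
  using has_lead_single[OF assms, of "1 :: 'k" 0] by simp

text \<open>
  Strict monotonicity of addition implies that among all pairs of exponents of \<open>p\<close> and \<open>q\<close> only
  \<open>(a, b)\<close> has sum \<open>a + b\<close>, so the product of the two leading coefficients does not cancel.
\<close>
lemma has_lead_mult:
  fixes p q :: "('n, 'k::field) mpoly"
  assumes \<tau>: "term_order \<tau>" and p: "has_lead \<tau> p a" and q: "has_lead \<tau> q b"
  shows "has_lead \<tau> (p * q) (a + b)"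
proof -
  note ord = term_order_props[OF \<tau>]
  have le: "(x + y, a + b) \<in> \<tau>" if "(x, a) \<in> \<tau>" "(y, b) \<in> \<tau>" for x y
    using ord(2)[of "x + y" "a + y"] ord(5)[OF that(1), of y] ord(5)[OF that(2), of a]
    by (simp add: add.commute)
  have eq: "x = a \<and> y = b" if "(x, a) \<in> \<tau>" "(y, b) \<in> \<tau>" "x + y = a + b" for x y
  proof -
    have "(x + b, a + b) \<in> \<tau>" "(x + y, x + b) \<in> \<tau>"
      using ord(5)[OF that(1), of b] ord(5)[OF that(2), of x] by (simp_all add: add.commute)
    then have "x + b = a + b" using ord(3) that(3) by metis
    with that(3) show ?thesis by simp
  qed
  have below: "Poly_Mapping.keys (p * q) \<subseteq> {c. (c, a + b) \<in> \<tau>}"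
    using keys_mult[of p q] p q le unfolding has_lead_def by fastforce
  let ?s = "\<lambda>p m. Poly_Mapping.single m (lkp p m)"
  have inner: "(\<Sum>y\<in>Poly_Mapping.keys q. if x = a then if y = b then c else 0 else 0)
      = (if x = a then c else 0)" for x and c :: 'k
    using q by (simp add: has_lead_def in_keys_iff)
  have "lkp (p * q) (a + b)
      = lkp ((\<Sum>x\<in>Poly_Mapping.keys p. ?s p x) * (\<Sum>y\<in>Poly_Mapping.keys q. ?s q y)) (a + b)"
    by (simp add: sum_single_lookup)
  also have "\<dots> = (\<Sum>x\<in>Poly_Mapping.keys p. \<Sum>y\<in>Poly_Mapping.keys q.
      if x = a then if y = b then lkp p a * lkp q b else 0 else 0)"
    unfolding sum_product lookup_sum mult_single using p q
    by (intro sum.cong refl) (auto simp: lookup_single when_def has_lead_def dest: eq)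
  also have "\<dots> = lkp p a * lkp q b"
    using p q by (simp add: inner has_lead_def in_keys_iff)
  finally show ?thesis
    using p q below by (auto simp: has_lead_def)
qed

lemma has_lead_power:
  fixes p :: "('n, 'k::field) mpoly"
  assumes "term_order \<tau>" "has_lead \<tau> p (unit_expo i)"
  shows "has_lead \<tau> (p ^ k) (Poly_Mapping.single i k)"
proof (induction k)
  case 0
  then show ?case using has_lead_one[OF assms(1)] by simp
next
  case (Suc k)
  then show ?case
    using has_lead_mult[OF assms Suc] by (simp add: unit_expo_def flip: single_add)
qed

lemma has_lead_prod:
  fixes p :: "'i \<Rightarrow> ('n, 'k::field) mpoly"
  assumes "term_order \<tau>" "\<And>i. i \<in> A \<Longrightarrow> has_lead \<tau> (p i) (a i)"
  shows "has_lead \<tau> (prod p A) (sum a A)"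
  using assms(2)
proof (induction A rule: infinite_finite_induct)
  case (insert x A)
  then show ?case by (simp add: has_lead_mult[OF assms(1)])
qed (simp_all add: has_lead_one[OF assms(1)])

text \<open>
  Since \<open>L\<close> is lower triangular, the image of \<open>X\<^sub>j\<close> involves only variables \<open>X\<^sub>i\<close> with \<open>j \<le> i\<close>;
  of these \<open>X\<^sub>j\<close> is the largest, so leading exponents of variables are preserved, and those of
  monomials by multiplicativity.
\<close>
lemma has_lead_gl_act_monomial:
  assumes \<tau>: "admissible_term_order \<tau>"
    and diag: "\<And>j. L $ j $ j \<noteq> 0" and lower: "\<And>i j. i < j \<Longrightarrow> L $ i $ j = 0"
  shows "has_lead \<tau> (gl_act L (monomial a)) a"
proof -
  have to: "term_order \<tau>" using \<tau> by (simp add: admissible_term_order_def)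
  have "has_lead \<tau> (linear_form L j) (unit_expo j)" for j
  proof -
    have *: "linear_form L j = (\<Sum>i\<in>UNIV. Poly_Mapping.single (unit_expo i) (L $ i $ j))"
      by (simp add: single_eq_const_mult_monomial)
    have inj: "unit_expo i = unit_expo k \<longleftrightarrow> i = k" for i k :: 'a
      by (metis keys_single one_neq_zero singleton_inject unit_expo_def)
    have "lkp (linear_form L j) (unit_expo j) = (\<Sum>i\<in>UNIV. if i = j then L $ j $ j else 0)"
      unfolding * lookup_sum by (intro sum.cong refl) (auto simp: lookup_single when_def inj)
    moreover have "(b, unit_expo j) \<in> \<tau>" if b: "b \<in> Poly_Mapping.keys (linear_form L j)" for b
    proof -
      obtain i where "b \<in> Poly_Mapping.keys (Poly_Mapping.single (unit_expo i) (L $ i $ j))"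
        using b unfolding * by (rule in_keys_sumE)
      then have i: "b = unit_expo i" "L $ i $ j \<noteq> 0" by (auto split: if_splits)
      then have "j \<le> i" using lower not_less by blast
      then show ?thesis
        using \<tau> i term_order_props(1)[OF to] by (cases "i = j") (auto simp: admissible_term_order_def)
    qed
    ultimately show ?thesis using diag by (simp add: has_lead_def)
  qed
  then have "has_lead \<tau> (\<Prod>j\<in>UNIV. linear_form L j ^ lkp a j)
      (\<Sum>j\<in>UNIV. Poly_Mapping.single j (lkp a j))"
    by (intro has_lead_prod has_lead_power to)
  then show ?thesis by (simp add: gl_act_monomial sum_single_expo)
qed

text \<open>
  The images of distinct monomials keep their distinct leading exponents, so the largest one cannot
  cancel.
\<close>
lemma has_lead_gl_act:
  assumes \<tau>: "admissible_term_order \<tau>"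
    and diag: "\<And>j. L $ j $ j \<noteq> 0" and lower: "\<And>i j. i < j \<Longrightarrow> L $ i $ j = 0"
    and f: "has_lead \<tau> f a"
  shows "has_lead \<tau> (gl_act L f) a"
proof -
  have to: "term_order \<tau>" using \<tau> by (simp add: admissible_term_order_def)
  note ord = term_order_props[OF to]
  note mon = has_lead_gl_act_monomial[OF \<tau> diag lower]
  have Lf: "gl_act L f = (\<Sum>m\<in>Poly_Mapping.keys f. const_poly (lkp f m) * gl_act L (monomial m))"
    by (subst sum_single_lookup[of f, symmetric])
      (simp only: gl_act_simps single_eq_const_mult_monomial gl_act_const_poly)
  have lead: "has_lead \<tau> (const_poly (lkp f m) * gl_act L (monomial m)) m"
    if "m \<in> Poly_Mapping.keys f" for m
    using has_lead_mult[OF to has_lead_single[OF to, of "lkp f m" 0] mon[of m]] that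
    by (simp add: const_poly_def in_keys_iff)
  have "(b, a) \<in> \<tau>" if b: "b \<in> Poly_Mapping.keys (gl_act L f)" for b
  proof -
    obtain m where m: "m \<in> Poly_Mapping.keys f"
      "b \<in> Poly_Mapping.keys (const_poly (lkp f m) * gl_act L (monomial m))"
      using b unfolding Lf by (rule in_keys_sumE)
    then have "(b, m) \<in> \<tau>" "(m, a) \<in> \<tau>" using lead f by (auto simp: has_lead_def)
    then show ?thesis by (rule ord(2))
  qed
  moreover have "lkp (gl_act L f) a
      = (\<Sum>m\<in>Poly_Mapping.keys f. if m = a then lkp (const_poly (lkp f a) * gl_act L (monomial a)) a else 0)"
    unfolding Lf lookup_sum
  proof (intro sum.cong refl)
    fix m assume m: "m \<in> Poly_Mapping.keys f"
    \<comment> \<open>All exponents of this image are at most \<open>m\<close>, which is below \<open>a\<close>.\<close>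
    have "lkp (const_poly (lkp f m) * gl_act L (monomial m)) a = 0" if "m \<noteq> a"
    proof (rule ccontr)
      assume "lkp (const_poly (lkp f m) * gl_act L (monomial m)) a \<noteq> 0"
      then have "(a, m) \<in> \<tau>" using lead[OF m] by (auto simp: has_lead_def in_keys_iff)
      moreover have "(m, a) \<in> \<tau>" using f m by (auto simp: has_lead_def)
      ultimately show False using ord(3) that by blast
    qed
    then show "lkp (const_poly (lkp f m) * gl_act L (monomial m)) a
      = (if m = a then lkp (const_poly (lkp f a) * gl_act L (monomial a)) a else 0)"
      by auto
  qed
  moreover have "a \<in> Poly_Mapping.keys f" using f by (simp add: has_lead_def in_keys_iff)
  ultimately show ?thesis
    using lead[of a] by (simp add: has_lead_def)
qed

lemma initial_ideal_gl_act_lower: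
  fixes F :: "('n::{finite,linorder}, 'k::field) mpoly set"
  assumes \<tau>: "admissible_term_order \<tau>"
    and diag: "\<And>j. L $ j $ j \<noteq> 0" and lower: "\<And>i j. i < j \<Longrightarrow> L $ i $ j = 0"
  shows "initial_ideal \<tau> (gl_act L ` F) = initial_ideal \<tau> F"
proof -
  have to: "term_order \<tau>" using \<tau> by (simp add: admissible_term_order_def)
  have *: "gl_act L f \<noteq> 0 \<and> lead_expo \<tau> (gl_act L f) = lead_expo \<tau> f" if "f \<noteq> 0" for f :: "('n, 'k) mpoly"
  proof -
    obtain a where a: "has_lead \<tau> f a" using has_lead_exists[OF to \<open>f \<noteq> 0\<close>] by blast
    note La = has_lead_gl_act[OF \<tau> diag lower a]
    show ?thesis
      using has_lead_lead_expo[OF to a] has_lead_lead_expo[OF to La] La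
      by (auto simp: has_lead_def)
  qed
  have "({monomial (lead_expo \<tau> f) |f. f \<in> gl_act L ` F \<and> f \<noteq> 0} :: ('n, 'k) mpoly set)
      = {monomial (lead_expo \<tau> f) |f. f \<in> F \<and> f \<noteq> (0 :: ('n, 'k) mpoly)}" (is "?A = ?B")
  proof
    show "?A \<subseteq> ?B"
    proof
      fix x assume "x \<in> ?A"
      then obtain f where f: "f \<in> F" "gl_act L f \<noteq> 0" "x = monomial (lead_expo \<tau> (gl_act L f))"
        by blast
      then have "f \<noteq> 0" by (auto simp: gl_act_simps)
      with f *[OF this] show "x \<in> ?B" by auto
    qed
    show "?B \<subseteq> ?A"
    proof
      fix x assume "x \<in> ?B"
      then obtain f where f: "f \<in> F" "f \<noteq> 0" "x = monomial (lead_expo \<tau> f)"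
        by blast
      with *[OF f(2)] show "x \<in> ?A" by (intro CollectI exI[of _ "gl_act L f"]) auto
    qed
  qed
  then show ?thesis by (simp add: initial_ideal_def)
qed

section \<open>Images of ideals\<close>

lemma module_times: "module ((*) :: 'r::comm_ring_1 \<Rightarrow> 'r \<Rightarrow> 'r)"
  by unfold_locales (simp_all add: algebra_simps)

lemma ideal_gen_closed:
  shows ideal_gen_base: "x \<in> G \<Longrightarrow> x \<in> ideal_gen G"
    and ideal_gen_zero: "0 \<in> ideal_gen G"
    and ideal_gen_add: "x \<in> ideal_gen G \<Longrightarrow> y \<in> ideal_gen G \<Longrightarrow> x + y \<in> ideal_gen G"
    and ideal_gen_diff: "x \<in> ideal_gen G \<Longrightarrow> y \<in> ideal_gen G \<Longrightarrow> x - y \<in> ideal_gen G"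
    and ideal_gen_mult: "x \<in> ideal_gen G \<Longrightarrow> r * x \<in> ideal_gen G"
    and ideal_gen_sum: "(\<And>i. i \<in> I \<Longrightarrow> f i \<in> ideal_gen G) \<Longrightarrow> sum f I \<in> ideal_gen G"
  unfolding ideal_gen_def
  by (fact module.span_base[OF module_times] module.span_zero[OF module_times]
      module.span_add[OF module_times] module.span_diff[OF module_times]
      module.span_scale[OF module_times] module.span_sum[OF module_times])+

lemma ring_map_ideal_gen:
  assumes h: "ring_map h" and G: "\<And>x. x \<in> G \<Longrightarrow> h x \<in> ideal_gen H" and x: "x \<in> ideal_gen G"
  shows "h x \<in> ideal_gen H"
proof -
  have "module.subspace (*) {x. h x \<in> ideal_gen H}"
    by (intro module.subspaceI[OF module_times])
      (auto simp: ring_mapD[OF h] ideal_gen_closed)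
  then have "module.span (*) G \<subseteq> {x. h x \<in> ideal_gen H}"
    using G by (intro module.span_minimal[OF module_times]) auto
  then show ?thesis using x by (auto simp: ideal_gen_def)
qed

section \<open>Borel moves\<close>

text \<open>
  In terms of monomials, \<open>i\<close> factors \<open>X\<^sub>k\<close> of \<open>X\<^sup>c\<close> are replaced by \<open>X\<^sub>j\<close>.  The subtraction
  is truncated, so this reading requires \<open>i \<le> c\<^sub>k\<close>.
\<close>
definition move :: "'n \<Rightarrow> 'n \<Rightarrow> nat \<Rightarrow> 'n expo \<Rightarrow> 'n expo"
  where "move j k i c = c + Poly_Mapping.single j i - Poly_Mapping.single k i"

lemma lookup_ivec: "lkp (ivec a) x = int (lkp a x)"
  by (simp add: ivec_def Poly_Mapping.map.rep_eq when_def)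

lemma ivec_eq_iff [simp]: "ivec a = ivec b \<longleftrightarrow> a = b"
  by (simp add: poly_mapping_eq_iff fun_eq_iff lookup_ivec)

lemma ivec_add: "ivec (a + b) = ivec a + ivec b"
  by (intro poly_mapping_eqI) (simp add: lookup_ivec lookup_add)

lemma move_zero [simp]: "move j k 0 c = c"
  by (simp add: move_def)

lemma move_add_single:
  assumes "i \<le> lkp c k"
  shows "move j k i c + Poly_Mapping.single k i = c + Poly_Mapping.single j i"
  using assms
  by (intro poly_mapping_eqI)
    (auto simp: move_def lookup_add lookup_minus lookup_single when_def)

lemma lookup_move_target: "j \<noteq> k \<Longrightarrow> lkp (move j k i c) j = lkp c j + i"
  by (simp add: move_def lookup_minus lookup_add lookup_single when_def)

lemma ivec_move:
  assumes "i \<le> lkp c k"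
  shows "ivec (move j k i c) = ivec c + (Poly_Mapping.single j (int i) - Poly_Mapping.single k (int i))"
proof -
  have "ivec (Poly_Mapping.single l i) = Poly_Mapping.single l (int i)" for l :: 'a
    by (intro poly_mapping_eqI) (simp add: lookup_ivec lookup_single when_def)
  then show ?thesis
    using arg_cong[OF move_add_single[OF assms, of j], of ivec]
    by (simp add: ivec_add algebra_simps)
qed

lemma move_in_expos:
  assumes "i \<le> lkp c k" "c \<in> expos d"
  shows "move j k i c \<in> expos d"
proof -
  have "total_deg (a + b) = total_deg a + total_deg b" for a b :: "'a expo"
    by (simp add: total_deg_def lookup_add sum.distrib)
  moreover have "total_deg (Poly_Mapping.single l i) = i" for l :: 'a
    by (simp add: total_deg_def lookup_single when_def)
  ultimately show ?thesis
    using arg_cong[OF move_add_single[OF assms(1), of j], of total_deg] assms(2)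
    by (simp add: expos_def)
qed

lemma sum_telescope_next_index:
  fixes j k :: "'n::{finite,linorder}"
  assumes "j \<le> k"
  shows "(\<Sum>l\<in>{j..<k}. Poly_Mapping.single l x - Poly_Mapping.single (next_index l) x)
    = Poly_Mapping.single j x - Poly_Mapping.single k (x :: int)"
  using assms
proof (induction "card {j..<k}" arbitrary: j rule: less_induct)
  case less
  show ?case
  proof (cases "j = k")
    case False
    with less.prems have jk: "j < k" by simp
    let ?j = "next_index j"
    have "?j \<in> {l. j < l}"
      unfolding next_index_def using jk by (intro Min_in) auto
    then have j: "j < ?j" "\<And>l. j < l \<Longrightarrow> ?j \<le> l"
      by (auto simp: next_index_def)
    have "x \<in> {j..<k} \<longleftrightarrow> x \<in> insert j {?j..<k}" for x
      using jk j(1) j(2)[of x] by (cases "j < x") auto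
    then have eq: "{j..<k} = insert j {?j..<k}"
      by (rule set_eqI)
    have notin: "j \<notin> {?j..<k}" using j(1) by auto
    have "card {?j..<k} < card {j..<k}"
      unfolding eq card_insert_disjoint[OF finite notin] by simp
    note IH = less.hyps[OF this j(2)[OF jk]]
    show ?thesis unfolding eq sum.insert[OF finite notin] IH by simp
  qed simp
qed

text \<open>
  The vector \<open>e\<^sub>j - e\<^sub>k\<close> is the sum of the simple differences \<open>e\<^sub>l - e\<^bsub>l+1\<^esub>\<close> for
  \<open>j \<le> l < k\<close>, which gives the witness for the Borel order.
\<close>
lemma borel_ge_move:
  fixes j k :: "'n::{finite,linorder}"
  assumes "j < k" "i \<le> lkp c k"
  shows "borel_ge (move j k i c) c"
proof -
  let ?\<alpha> = "\<lambda>l. if l \<in> {j..<k} then i else 0"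
  have "(\<Sum>l\<in>UNIV - {Max UNIV}. Poly_Mapping.single l (int (?\<alpha> l))
        - Poly_Mapping.single (next_index l) (int (?\<alpha> l)))
      = (\<Sum>l\<in>{j..<k}. Poly_Mapping.single l (int i) - Poly_Mapping.single (next_index l) (int i))"
  proof (intro sum.mono_neutral_cong_right)
    show "{j..<k} \<subseteq> UNIV - {Max UNIV}"
      by (auto simp: not_less[symmetric])
  qed auto
  then have "ivec (move j k i c) - ivec c
      = (\<Sum>l\<in>UNIV - {Max UNIV}. Poly_Mapping.single l (int (?\<alpha> l))
        - Poly_Mapping.single (next_index l) (int (?\<alpha> l)))"
    using sum_telescope_next_index[of j k "int i"] assms by (simp add: ivec_move)
  then show ?thesis unfolding borel_ge_def by (intro exI[of _ ?\<alpha>])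
qed

lemma borel_set_move:
  assumes "borel_set d B" "c \<in> B" "j < k" "i \<le> lkp c k"
  shows "move j k i c \<in> B"
  using assms borel_ge_move[OF assms(3,4)] move_in_expos[OF assms(4)]
  by (auto simp: borel_set_def)

section \<open>Transvections\<close>

text \<open>
  As a substitution it replaces \<open>X\<^sub>k\<close> by \<open>X\<^sub>k + s X\<^sub>j\<close> and fixes the other variables.
\<close>
definition transvection :: "'n \<Rightarrow> 'n \<Rightarrow> 'k::field \<Rightarrow> 'k ^ 'n ^ 'n"
  where "transvection j k s = (\<chi> a b. (if a = b then 1 else 0) + (if a = j \<and> b = k then s else 0))"

lemma transvection_mult:
  fixes M :: "'k::field ^ 'n::finite ^ 'n"
  shows "(transvection j k s ** M) $ a $ b = M $ a $ b + (if a = j then s * M $ k $ b else 0)"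
proof -
  have "(transvection j k s ** M) $ a $ b
      = (\<Sum>l\<in>UNIV. (if l = a then M $ a $ b else 0) + (if l = k then if a = j then s * M $ k $ b else 0 else 0))"
    unfolding matrix_matrix_mult_def transvection_def vec_lambda_beta
    by (intro sum.cong refl) (auto simp: algebra_simps)
  then show ?thesis by (simp add: sum.distrib)
qed

lemma transvection_inverse:
  assumes "j \<noteq> k"
  shows "transvection j k s ** transvection j k (- s) = (mat 1 :: 'k::field ^ 'n::finite ^ 'n)"
  using assms by (simp add: vec_eq_iff transvection_mult) (simp add: transvection_def mat_def)

lemma linear_form_transvection:
  fixes s :: "'k::field" and j k :: "'n::finite"
  shows "linear_form (transvection j k s) b
    = (if b = k then const_poly s * monomial (unit_expo j) + monomial (unit_expo k)
       else monomial (unit_expo b))"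
proof -
  have "linear_form (transvection j k s) b
      = (\<Sum>i\<in>UNIV. (if i = b then monomial (unit_expo b) else 0)
          + (if i = j then if b = k then const_poly s * monomial (unit_expo j) else 0 else 0))"
    by (intro sum.cong refl)
      (auto simp: transvection_def ring_mapD[OF ring_map_const_poly] algebra_simps)
  then show ?thesis by (auto simp: sum.distrib)
qed

text \<open>
  This is the binomial expansion of the power of \<open>X\<^sub>k + s X\<^sub>j\<close> that replaces the power of \<open>X\<^sub>k\<close>
  in \<open>X\<^sup>c\<close>; the remaining factors, collected in \<open>?r\<close>, are fixed.
\<close>
lemma gl_act_transvection_monomial:
  fixes s :: "'k::field" and c :: "'n::finite expo"
  assumes "j \<noteq> k"
  shows "gl_act (transvection j k s) (monomial c)
    = (\<Sum>i\<le>lkp c k. const_poly (of_nat (lkp c k choose i) * s ^ i) * monomial (move j k i c))"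
proof -
  let ?n = "lkp c k"
  let ?r = "\<Sum>b\<in>UNIV - {k}. Poly_Mapping.single b (lkp c b)"
  have r: "lkp ?r x = (if x = k then 0 else lkp c x)" for x
    unfolding lookup_sum by (auto simp: lookup_single when_def)
  have of_nat_eq: "(of_nat m :: ('n, 'k) mpoly) = const_poly (of_nat m)" for m
    by (simp add: const_poly_def)
  have mv: "move j k i c = Poly_Mapping.single j i + Poly_Mapping.single k (?n - i) + ?r"
    if "i \<le> ?n" for i
    using that assms
    by (intro poly_mapping_eqI)
      (auto simp: move_def lookup_add lookup_minus r, auto simp: lookup_single when_def)
  have "gl_act (transvection j k s) (monomial c)
      = (const_poly s * monomial (unit_expo j) + monomial (unit_expo k)) ^ ?n * monomial ?r"
    by (simp add: gl_act_monomial linear_form_transvection prod.remove[of UNIV k] monomial_sum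
        flip: monomial_power)
  also have "\<dots> = (\<Sum>i\<le>?n. of_nat (?n choose i) * (const_poly s * monomial (unit_expo j)) ^ i
      * monomial (unit_expo k) ^ (?n - i) * monomial ?r)"
    unfolding binomial_ring sum_distrib_right ..
  also have "\<dots> = (\<Sum>i\<le>?n. const_poly (of_nat (?n choose i) * s ^ i) * monomial (move j k i c))"
  proof (intro sum.cong refl)
    fix i assume "i \<in> {..?n}"
    then have mvE: "monomial (move j k i c)
        = monomial (unit_expo j) ^ i * monomial (unit_expo k) ^ (?n - i) * monomial ?r"
      by (simp add: mv monomial_add monomial_power)
    then show "of_nat (?n choose i) * (const_poly s * monomial (unit_expo j)) ^ i
        * monomial (unit_expo k) ^ (?n - i) * monomial ?r
      = const_poly (of_nat (?n choose i) * s ^ i) * monomial (move j k i c)"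
      unfolding mvE of_nat_eq
      by (simp add: ring_mapD[OF ring_map_const_poly] power_mult_distrib ac_simps)
  qed
  finally show ?thesis .
qed

section \<open>Stability under upper unipotent substitutions\<close>

lemma lookup_above_max_index:
  assumes "max_index \<rho> < i"
  shows "lkp \<rho> i = 0"
proof (rule ccontr)
  assume "lkp \<rho> i \<noteq> 0"
  then have "i \<le> max_index \<rho>" unfolding max_index_def by (intro Max_ge) auto
  with assms show False by simp
qed

text \<open>
  All monomials in the image of a generator have Borel larger exponents.  They reduce to zero or pair
  up to generators, either because the moves for \<open>c\<close> and \<open>c + \<rho>\<close> run in parallel (\<open>k\<close> beyond the
  support of \<open>\<rho>\<close>), or because every proper move ends in \<open>A\<close>, as it changes a coordinate at which all
  elements of \<open>C\<close> agree.
\<close>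
lemma gl_act_transvection_generator:
  fixes A C :: "'n::{finite,linorder} expo set" and s :: "'k::field"
  assumes good: "good_binomial_system d A C \<rho>" and jk: "j < k"
    and x: "x \<in> monomial ` A \<union> {monomial c - monomial b |c b. c \<in> C \<and> ivec b = ivec c + \<rho>}"
  shows "gl_act (transvection j k s) x \<in> binomial_ideal A C \<rho>"
proof -
  let ?F = "binomial_ideal A C \<rho> :: ('n, 'k) mpoly set"
  let ?g = "gl_act (transvection j k s)"
  let ?t = "\<lambda>c i. const_poly (of_nat (lkp c k choose i) * s ^ i) :: ('n, 'k) mpoly"
  let ?G = "monomial ` A \<union> {monomial c - monomial b |c b. c \<in> C \<and> ivec b = ivec c + \<rho>} :: ('n, 'k) mpoly set"
  note closed = ideal_gen_closed[where G = ?G, folded binomial_ideal_def]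
  have borel: "borel_set d (A \<union> C)" "borel_set d (A \<union> translate \<rho> C)"
    and disj: "A \<inter> C = {}" "A \<inter> translate \<rho> C = {}" "C \<inter> translate \<rho> C = {}"
    and const: "\<And>b c i. b \<in> C \<Longrightarrow> c \<in> C \<Longrightarrow> i < max_index \<rho> \<Longrightarrow> lkp b i = lkp c i"
    using good unfolding good_binomial_system_def admissible_binomial_system_def binomial_system_def
    by - (elim conjE, assumption | blast)+
  have act: "?g (monomial c) = (\<Sum>i\<le>lkp c k. ?t c i * monomial (move j k i c))" for c
    using jk by (intro gl_act_transvection_monomial) simp
  have A_mem: "r * monomial a \<in> ?F" if "a \<in> A" for a r
    using that by (intro closed(5) closed(1)) auto
  from x consider (monom) a where "a \<in> A" "x = monomial a"
    | (binom) c b where "c \<in> C" "ivec b = ivec c + \<rho>" "x = monomial c - monomial b"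
    by auto
  then show ?thesis
  proof cases
    case monom
    have "move j k i a \<in> A" if "i \<le> lkp a k" for i
      using borel_set_move[OF borel(1) _ jk that] borel_set_move[OF borel(2) _ jk that] monom disj
      by auto
    then show ?thesis unfolding monom act by (intro closed(6) A_mem) auto
  next
    case binom
    have b: "b \<in> translate \<rho> C" using binom by (auto simp: translate_def)
    have coord: "int (lkp b l) = int (lkp c l) + lkp \<rho> l" for l
      using arg_cong[OF binom(2), of "\<lambda>p. lkp p l"] by (simp add: lookup_ivec lookup_add)
    have cC: "move j k i c \<in> A \<union> C" if "i \<le> lkp c k" for i
      using borel_set_move[OF borel(1) _ jk that] binom by auto
    have bC: "move j k i b \<in> A \<union> translate \<rho> C" if "i \<le> lkp b k" for i
      using borel_set_move[OF borel(2) _ jk that] b by auto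
    have gen: "monomial c - monomial b \<in> ?F"
      using binom by (intro closed(1)) auto
    show ?thesis
    proof (cases "max_index \<rho> < k")
      case True
      \<comment> \<open>The two expansions have the same length and the same coefficients.\<close>
      then have eq: "lkp b k = lkp c k" using lookup_above_max_index[OF True] coord[of k] by simp
      have "monomial (move j k i c) - monomial (move j k i b) \<in> ?F" if i: "i \<le> lkp c k" for i
      proof -
        have tr: "ivec (move j k i b) = ivec (move j k i c) + \<rho>"
          using i eq binom(2) by (simp add: ivec_move algebra_simps)
        show ?thesis
        proof (cases "move j k i c \<in> C")
          case True
          then show ?thesis using tr by (intro closed(1)) auto
        next
          case False
          then have "move j k i c \<in> A" "move j k i b \<in> A"
            using cC[OF i] bC[of i] i eq tr by (auto simp: translate_def)
          then show ?thesis using A_mem[of _ 1] closed(4) by simp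
        qed
      qed
      then have "(\<Sum>i\<le>lkp c k. ?t c i * (monomial (move j k i c) - monomial (move j k i b))) \<in> ?F"
        by (intro closed(6) closed(5)) auto
      moreover have "?g x = (\<Sum>i\<le>lkp c k. ?t c i * (monomial (move j k i c) - monomial (move j k i b)))"
        unfolding binom gl_act_simps act eq by (simp add: sum_subtractf right_diff_distrib)
      ultimately show ?thesis by simp
    next
      case False
      then have j: "j < max_index \<rho>" using jk by simp
      \<comment> \<open>The move by \<open>i = 0\<close> reproduces the generator itself; the others are shown to lie in \<open>A\<close>.\<close>
      have "move j k i c \<in> A" if "i \<in> {1..lkp c k}" for i
        using cC[of i] const[OF _ \<open>c \<in> C\<close> j, of "move j k i c"] lookup_move_target[of j k i c] that jk
        by auto
      then have c: "(\<Sum>i\<in>{1..lkp c k}. ?t c i * monomial (move j k i c)) \<in> ?F"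
        by (intro closed(6) A_mem)
      have "move j k i b \<in> A" if i: "i \<in> {1..lkp b k}" for i
      proof (rule ccontr)
        assume "move j k i b \<notin> A"
        then obtain c' where c': "c' \<in> C" "ivec (move j k i b) = ivec c' + \<rho>"
          using bC[of i] i by (auto simp: translate_def)
        have "int (lkp b j) + int i = int (lkp c' j) + lkp \<rho> j"
          using arg_cong[OF c'(2), of "\<lambda>p. lkp p j"] lookup_move_target[of j k i b] jk
          by (simp add: lookup_ivec lookup_add)
        then show False using coord[of j] const[OF c'(1) \<open>c \<in> C\<close> j] i by simp
      qed
      then have b: "(\<Sum>i\<in>{1..lkp b k}. ?t b i * monomial (move j k i b)) \<in> ?F"
        by (intro closed(6) A_mem)
      have split: "?g (monomial a) = monomial a + (\<Sum>i\<in>{1..lkp a k}. ?t a i * monomial (move j k i a))" for a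
        unfolding act
        by (simp add: atMost_atLeast0 sum.atLeast_Suc_atMost[of 0] ring_mapD[OF ring_map_const_poly])
      have "?g x = (monomial c - monomial b) + (\<Sum>i\<in>{1..lkp c k}. ?t c i * monomial (move j k i c))
          - (\<Sum>i\<in>{1..lkp b k}. ?t b i * monomial (move j k i b))"
        unfolding binom gl_act_simps split by simp
      then show ?thesis using closed(3,4) gen b c by simp
    qed
  qed
qed

text \<open>
  The inverse of a transvection is a transvection at the same position, so stability gives equality.
\<close>
lemma gl_act_transvection_image:
  fixes s :: "'k::field"
  assumes "good_binomial_system d A C \<rho>" "j < k"
  shows "gl_act (transvection j k s) ` binomial_ideal A C \<rho> = binomial_ideal A C \<rho>"
proof
  let ?F = "binomial_ideal A C \<rho> :: ('a, 'k) mpoly set"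
  have sub: "gl_act (transvection j k s) x \<in> ?F" if "x \<in> ?F" for x s
    unfolding binomial_ideal_def
  proof (rule ring_map_ideal_gen[OF ring_map_gl_act[of "transvection j k s"]])
    show "x \<in> ideal_gen (monomial ` A \<union> {monomial c - monomial b |c b. c \<in> C \<and> ivec b = ivec c + \<rho>})"
      using that by (simp only: binomial_ideal_def)
  qed (fact gl_act_transvection_generator[OF assms, unfolded binomial_ideal_def])
  then show "gl_act (transvection j k s) ` ?F \<subseteq> ?F" by auto
  show "?F \<subseteq> gl_act (transvection j k s) ` ?F"
  proof
    fix x assume "x \<in> ?F"
    moreover have "x = gl_act (transvection j k s) (gl_act (transvection j k (- s)) x)"
      using assms(2) by (simp add: gl_act_gl_act transvection_inverse gl_act_mat_1)
    ultimately show "x \<in> gl_act (transvection j k s) ` ?F" using sub by blast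
  qed
qed

definition upper_unipotent :: "'k::field ^ 'n::{finite,linorder} ^ 'n::{finite,linorder} \<Rightarrow> bool"
  where "upper_unipotent V \<longleftrightarrow> (\<forall>a. V $ a $ a = 1) \<and> (\<forall>a b. b < a \<longrightarrow> V $ a $ b = 0)"

text \<open>
  Upper unipotent matrices are products of transvections.  A nonzero entry above the diagonal in
  the last column \<open>k\<close> that has such an entry can be split off as a left factor: row \<open>k\<close> of the
  remaining matrix is a row of the identity matrix, so the factor changes only the entry \<open>(j, k)\<close>.
  Induction is on the number of nonzero entries above the diagonal.
\<close>
lemma gl_act_upper_unipotent_image:
  fixes V :: "'k::field ^ 'n::{finite,linorder} ^ 'n::{finite,linorder}"
  assumes F: "\<And>j k s. j < k \<Longrightarrow> gl_act (transvection j k s) ` F = F"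
    and V: "upper_unipotent V"
  shows "gl_act V ` F = F"
  using V
proof (induction "card {(a, b). a < b \<and> V $ a $ b \<noteq> 0}" arbitrary: V rule: less_induct)
  case less
  let ?N = "\<lambda>V :: 'k ^ 'n::{finite,linorder} ^ 'n::{finite,linorder}. {(a, b). a < b \<and> V $ a $ b \<noteq> 0}"
  have diag: "V $ a $ a = 1" and low: "b < a \<Longrightarrow> V $ a $ b = 0" for a b
    using less.prems by (auto simp: upper_unipotent_def)
  show ?case
  proof (cases "?N V = {}")
    case True
    have "V $ a $ b = mat 1 $ a $ b" for a b
      using True diag low[of b a] by (cases a b rule: linorder_cases) (auto simp: mat_def)
    then have "V = mat 1" by (simp add: vec_eq_iff)
    then show ?thesis by (simp add: gl_act_mat_1)
  next
    case False
    define k where "k = Max (snd ` ?N V)"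
    have fin: "finite (?N V)" by (rule finite_subset[of _ UNIV]) auto
    have "k \<in> snd ` ?N V" unfolding k_def using False fin by (intro Max_in) auto
    then obtain j where j: "j < k" "V $ j $ k \<noteq> 0" by auto
    have row: "V $ k $ b = 0" if "k < b" for b
    proof (rule ccontr)
      assume "V $ k $ b \<noteq> 0"
      then have "b \<in> snd ` ?N V" using that by force
      then have "b \<le> k" unfolding k_def using fin by (intro Max_ge) auto
      with that show False by simp
    qed
    define V' where "V' = (\<chi> a b. if a = j \<and> b = k then 0 else V $ a $ b)"
    have V'k: "V' $ k $ b = (if b = k then 1 else 0)" for b
      using row[of b] diag low[of b k] j(1) by (cases b k rule: linorder_cases) (auto simp: V'_def)
    have "V = transvection j k (V $ j $ k) ** V'"
      by (simp add: vec_eq_iff transvection_mult V'k) (auto simp: V'_def)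
    moreover have "gl_act V' ` F = F"
    proof (rule less.hyps)
      have "?N V' \<subset> ?N V" using j by (auto simp: V'_def split: if_splits)
      then show "card (?N V') < card (?N V)" using fin by (rule psubset_card_mono[rotated])
      show "upper_unipotent V'" using less.prems j(1) by (auto simp: upper_unipotent_def V'_def)
    qed
    ultimately have "gl_act V ` F = gl_act (transvection j k (V $ j $ k)) ` gl_act V' ` F"
      by (metis (no_types, lifting) gl_act_gl_act image_cong image_image)
    also have "\<dots> = F" using \<open>gl_act V' ` F = F\<close> F[OF j(1)] by simp
    finally show ?thesis .
  qed
qed

section \<open>Triangular decomposition\<close>

text \<open>Outside of the rows and columns in \<open>S\<close> it is the identity matrix, so its determinant is the
  principal minor of \<open>g\<close> on \<open>S\<close>.\<close>
definition principal_block :: "'n set \<Rightarrow> 'k::comm_ring_1 ^ 'n ^ 'n \<Rightarrow> 'k ^ 'n ^ 'n"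
  where "principal_block S g = (\<chi> i j. if i \<in> S \<and> j \<in> S then g $ i $ j else if i = j then 1 else 0)"

lemma principal_block_mult_vec:
  fixes g :: "'k::field ^ 'n ^ 'n::finite"
  shows "(principal_block S g *v u) $ i = (if i \<in> S then \<Sum>k\<in>S. g $ i $ k * u $ k else u $ i)"
proof -
  have "(principal_block S g *v u) $ i
      = (\<Sum>k\<in>UNIV. if i \<in> S then if k \<in> S then g $ i $ k * u $ k else 0 else if k = i then u $ i else 0)"
    unfolding matrix_vector_mult_def principal_block_def vec_lambda_beta
    by (intro sum.cong refl) auto
  then show ?thesis by (auto simp: sum.If_cases)
qed

text \<open>
  The conditions on the entries of \<open>u\<close> before position \<open>j\<close> form a linear system whose matrix is the
  leading block of size \<open>j - 1\<close>.  If \<open>g u\<close> also vanished at \<open>j\<close>, then \<open>u\<close> would be a nonzero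
  kernel vector of the leading block of size \<open>j\<close>.
\<close>
lemma exists_column:
  fixes g :: "'k::field ^ 'n::{finite,linorder} ^ 'n::{finite,linorder}"
  assumes "det (principal_block {..<j} g) \<noteq> 0" "det (principal_block {..j} g) \<noteq> 0"
  shows "\<exists>u. u j = 1 \<and> (\<forall>i>j. u i = 0) \<and> (\<forall>i<j. (\<Sum>k\<in>UNIV. g $ i $ k * u k) = 0)
    \<and> (\<Sum>k\<in>UNIV. g $ j $ k * u k) \<noteq> 0"
proof -
  \<comment> \<open>Rows from \<open>j\<close> on of the block are rows of the identity matrix, so \<open>w\<close> prescribes the
    entries of \<open>u\<close> there.\<close>
  define w where "w = (\<chi> i. if i < j then - g $ i $ j else if i = j then 1 else 0)"
  obtain B where "principal_block {..<j} g ** B = mat 1"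
    using assms(1) by (auto simp: invertible_det_nz[symmetric] invertible_def)
  then have "principal_block {..<j} g *v (B *v w) = w"
    by (simp add: matrix_vector_mul_assoc)
  then obtain u where u: "principal_block {..<j} g *v u = w" ..
  have row: "(if i < j then \<Sum>k\<in>{..<j}. g $ i $ k * u $ k else u $ i) = w $ i" for i
    using arg_cong[OF u, of "\<lambda>v. v $ i"] by (simp add: principal_block_mult_vec)
  have above: "u $ i = 0" if "j < i" for i
    using row[of i] that by (simp add: w_def split: if_splits)
  have uj: "u $ j = 1" using row[of j] by (simp add: w_def)
  have full: "(\<Sum>k\<in>UNIV. g $ i $ k * u $ k) = (\<Sum>k\<in>{..j}. g $ i $ k * u $ k)" for i
    using above by (intro sum.mono_neutral_right) (auto simp: not_le)
  have zero: "(\<Sum>k\<in>UNIV. g $ i $ k * u $ k) = 0" if "i < j" for i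
  proof -
    have "{..j} = insert j {..<j}" by auto
    then have "(\<Sum>k\<in>{..j}. g $ i $ k * u $ k) = g $ i $ j + w $ i"
      using row[of i] that uj by simp
    then show ?thesis using that by (simp add: full w_def)
  qed
  have "(\<Sum>k\<in>UNIV. g $ j $ k * u $ k) \<noteq> 0"
  proof
    assume "(\<Sum>k\<in>UNIV. g $ j $ k * u $ k) = 0"
    then have "principal_block {..j} g *v u = 0"
      using zero above by (auto simp: vec_eq_iff principal_block_mult_vec full not_le order_le_less)
    moreover obtain B where "B ** principal_block {..j} g = mat 1"
      using assms(2) by (auto simp: invertible_det_nz[symmetric] invertible_def)
    ultimately have "u = 0"
      by (metis matrix_vector_mul_assoc matrix_vector_mul_lid matrix_vector_mult_0_right)
    with uj show False by simp
  qed
  then show ?thesis using uj above zero by (intro exI[of _ "\<lambda>i. u $ i"]) auto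
qed

text \<open>
  This is the LU decomposition in the form \<open>g V = L\<close>, in which the columns of \<open>V\<close> can be found
  independently of each other.
\<close>
lemma exists_upper_unipotent:
  fixes g :: "'k::field ^ 'n::{finite,linorder} ^ 'n::{finite,linorder}"
  assumes "\<And>j. det (principal_block {..<j} g) \<noteq> 0" "\<And>j. det (principal_block {..j} g) \<noteq> 0"
  obtains V where "upper_unipotent V" "\<And>j. (g ** V) $ j $ j \<noteq> 0" "\<And>i j. i < j \<Longrightarrow> (g ** V) $ i $ j = 0"
proof -
  obtain u where u: "\<And>j. u j j = 1" "\<And>i j. j < i \<Longrightarrow> u j i = 0"
    "\<And>i j. i < j \<Longrightarrow> (\<Sum>k\<in>UNIV. g $ i $ k * u j k) = 0" "\<And>j. (\<Sum>k\<in>UNIV. g $ j $ k * u j k) \<noteq> 0"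
    using exists_column[OF assms] by metis
  show ?thesis
  proof (rule that[of "\<chi> i j. u j i"])
    show "upper_unipotent (\<chi> i j. u j i)" using u(1,2) by (auto simp: upper_unipotent_def)
    show "(g ** (\<chi> i j. u j i)) $ j $ j \<noteq> 0" for j
      using u(4)[of j] by (simp add: matrix_matrix_mult_def)
    show "(g ** (\<chi> i j. u j i)) $ i $ j = 0" if "i < j" for i j
      using u(3)[OF that] by (simp add: matrix_matrix_mult_def)
  qed
qed

text \<open>
  The upper unipotent factor is absorbed by \<open>F\<close>, and the lower triangular one preserves leading
  exponents.
\<close>
lemma initial_ideal_gl_act_generic:
  fixes g :: "'k::field ^ 'n::{finite,linorder} ^ 'n::{finite,linorder}"
  assumes \<tau>: "admissible_term_order \<tau>"
    and F: "\<And>j k s. j < k \<Longrightarrow> gl_act (transvection j k s) ` F = F"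
    and g: "\<And>j. det (principal_block {..<j} g) \<noteq> 0" "\<And>j. det (principal_block {..j} g) \<noteq> 0"
  shows "initial_ideal \<tau> (gl_act g ` F) = initial_ideal \<tau> F"
proof -
  obtain V where V: "upper_unipotent V" "\<And>j. (g ** V) $ j $ j \<noteq> 0" "\<And>i j. i < j \<Longrightarrow> (g ** V) $ i $ j = 0"
    using exists_upper_unipotent[OF g] by blast
  have "gl_act g ` F = gl_act g ` gl_act V ` F"
    using gl_act_upper_unipotent_image[OF F V(1)] by simp
  also have "\<dots> = gl_act (g ** V) ` F"
    by (simp add: image_image gl_act_gl_act)
  finally show ?thesis
    using initial_ideal_gl_act_lower[OF \<tau> V(2,3)] by simp
qed

section \<open>The open cell and its density\<close>

text \<open>
  Applied to evaluation homomorphisms, this shows that minors of a matrix are polynomials in its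
  entries.
\<close>
lemma ring_map_det:
  fixes M :: "'r::comm_ring_1 ^ 'n ^ 'n"
  assumes h: "ring_map h"
  shows "h (det M) = det (\<chi> i j. h (M $ i $ j))"
proof -
  have "h (of_int (sign p)) = of_int (sign p)" for p :: "'n \<Rightarrow> 'n"
    using ring_mapD(5)[OF h, of 0 1] by (auto simp: sign_def ring_mapD[OF h])
  then show ?thesis by (simp add: det_def ring_mapD[OF h])
qed

abbreviation generic_matrix :: "('n \<times> 'n, 'k::field) mpoly ^ 'n ^ 'n"
  where "generic_matrix \<equiv> (\<chi> i j. monomial (unit_expo (i, j)))"

abbreviation entries :: "'k ^ 'n ^ 'n \<Rightarrow> 'n \<times> 'n \<Rightarrow> 'k"
  where "entries g \<equiv> (\<lambda>(i, j). g $ i $ j)"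

lemma eval_det_principal_block:
  fixes g :: "'k::field ^ 'n ^ 'n::finite"
  shows "eval_poly id (entries g) (det (principal_block S generic_matrix)) = det (principal_block S g)"
proof -
  note h = ring_map_eval_poly[OF ring_map_id, of "entries g"]
  have "(\<chi> i j. eval_poly id (entries g) (principal_block S generic_matrix $ i $ j)) = principal_block S g"
    by (simp add: vec_eq_iff principal_block_def ring_mapD[OF h] eval_poly_unit_expo ring_map_id)
  then show ?thesis by (simp add: ring_map_det[OF h])
qed

text \<open>
  The nonvanishing locus of this polynomial is the set of invertible matrices with an LU decomposition.
  The blocks \<open>{..<j}\<close> are the empty block and the blocks \<open>{..j'}\<close> for the predecessors \<open>j'\<close>; having
  both kinds as factors treats the first index like the others.
\<close>
definition minors_product :: "('n::{finite,linorder} \<times> 'n, 'k::field) mpoly"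
  where "minors_product = (\<Prod>j\<in>UNIV. det (principal_block {..<j} generic_matrix)
    * det (principal_block {..j} generic_matrix))"

lemma eval_minors_product:
  "eval_poly id (entries g) minors_product \<noteq> 0
    \<longleftrightarrow> (\<forall>j. det (principal_block {..<j} g) \<noteq> 0 \<and> det (principal_block {..j} g) \<noteq> 0)"
  by (simp add: minors_product_def ring_mapD[OF ring_map_eval_poly[OF ring_map_id]]
      eval_det_principal_block)

lemma eval_minors_product_mat_1:
  "eval_poly id (entries (mat 1)) (minors_product :: ('n::{finite,linorder} \<times> 'n, 'k::field) mpoly) \<noteq> 0"
proof -
  have "principal_block S (mat 1) = (mat 1 :: 'k ^ 'n::{finite,linorder} ^ 'n::{finite,linorder})" for S
    by (auto simp: vec_eq_iff principal_block_def mat_def)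
  then show ?thesis by (simp add: eval_minors_product)
qed

lemma invertible_if_eval_minors_product:
  fixes g :: "'k::field ^ 'n::{finite,linorder} ^ 'n::{finite,linorder}"
  assumes "eval_poly id (entries g) minors_product \<noteq> 0"
  shows "invertible g"
proof -
  have "{..Max UNIV} = (UNIV :: 'n set)" by auto
  moreover have "principal_block UNIV g = g" by (simp add: vec_eq_iff principal_block_def)
  ultimately show ?thesis using assms by (metis eval_minors_product invertible_det_nz)
qed

text \<open>
  Restricted to the line through \<open>g\<close> and \<open>g'\<close>, both \<open>p\<close> and \<open>q\<close> become nonzero polynomials in
  one variable, and their product has only finitely many roots in the infinite field.
\<close>
lemma nonzeros_intersect:
  fixes p q :: "('n::finite \<times> 'n, 'k::field_char_0) mpoly"
  assumes "eval_poly id (entries g) p \<noteq> 0" "eval_poly id (entries g') q \<noteq> 0"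
  shows "\<exists>m. eval_poly id (entries m) p \<noteq> 0 \<and> eval_poly id (entries m) q \<noteq> 0"
proof -
  define line where "line s = (\<chi> i j. g $ i $ j + s * (g' $ i $ j - g $ i $ j))" for s
  define res :: "('n \<times> 'n, 'k) mpoly \<Rightarrow> 'k poly"
    where "res = eval_poly (\<lambda>c. [:c:]) (\<lambda>(i, j). [:g $ i $ j, g' $ i $ j - g $ i $ j:])"
  have res: "poly (res r) s = eval_poly id (entries (line s)) r" for r s
  proof -
    have h: "ring_map (\<lambda>r. poly r s)" by (simp add: ring_map_def)
    have "(\<lambda>r. poly r s) \<circ> (\<lambda>c. [:c:]) = id" by auto
    moreover have "(\<lambda>r. poly r s) \<circ> (\<lambda>(i, j). [:g $ i $ j, g' $ i $ j - g $ i $ j:]) = entries (line s)"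
      by (auto simp: line_def)
    ultimately show ?thesis unfolding res_def ring_map_eval_poly_comp[OF h] by simp
  qed
  have "line 0 = g" "line 1 = g'" by (simp_all add: line_def vec_eq_iff)
  then have "res p \<noteq> 0" "res q \<noteq> 0"
    using res[of p 0] res[of q 1] assms by auto
  then have "finite {s. poly (res p * res q) s = 0}" by (intro poly_roots_finite) simp
  then obtain s where "poly (res p * res q) s \<noteq> 0"
    using infinite_UNIV_char_0[where ?'a = 'k] by (metis (mono_tags, lifting) UNIV_eq_I mem_Collect_eq)
  then show ?thesis by (auto simp: res)
qed

theorem theorem3p16:
  fixes A C :: "'n::{finite,linorder} expo set"
    and \<rho> :: "'n \<Rightarrow>\<^sub>0 int"
    and d :: nat
    and \<tau> :: "'n expo rel"
  assumes "d \<ge> 1"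
    and "good_binomial_system d A C \<rho>"
    and "admissible_term_order \<tau>"
  shows "Gin \<tau> (binomial_ideal A C \<rho> :: ('n, 'k::field_char_0) mpoly set)
       = initial_ideal \<tau> (binomial_ideal A C \<rho>)"
proof -
  let ?F = "binomial_ideal A C \<rho> :: ('n, 'k) mpoly set"
  let ?p = "minors_product :: ('n \<times> 'n, 'k) mpoly"
  define U where "U = {g. g \<in> GL \<and> (\<exists>p\<in>{?p}. eval_poly id (entries g) p \<noteq> 0)}"
  have generic: "initial_ideal \<tau> (gl_act g ` ?F) = initial_ideal \<tau> ?F"
    if "eval_poly id (entries g) ?p \<noteq> 0" for g
    using that unfolding eval_minors_product
    by (intro initial_ideal_gl_act_generic assms(3) gl_act_transvection_image[OF assms(2)]) auto
  show ?thesis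
    unfolding Gin_def
  proof (rule the_equality)
    have "zariski_open_GL U" unfolding zariski_open_GL_def U_def by blast
    moreover have "mat 1 \<in> U"
      using eval_minors_product_mat_1[where ?'n = 'n and ?'k = 'k] invertible_if_eval_minors_product
      by (auto simp: U_def GL_def)
    moreover have "\<forall>g\<in>U. initial_ideal \<tau> (gl_act g ` ?F) = initial_ideal \<tau> ?F"
      using generic by (auto simp: U_def)
    ultimately show "\<exists>U. zariski_open_GL U \<and> U \<noteq> {} \<and>
      (\<forall>g\<in>U. initial_ideal \<tau> (gl_act g ` ?F) = initial_ideal \<tau> ?F)"
      by blast
  next
    fix J
    assume "\<exists>U. zariski_open_GL U \<and> U \<noteq> {} \<and> (\<forall>g\<in>U. initial_ideal \<tau> (gl_act g ` ?F) = J)"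
    then obtain P g0 where J: "\<And>g p. g \<in> GL \<Longrightarrow> p \<in> P \<Longrightarrow> eval_poly id (entries g) p \<noteq> 0
        \<Longrightarrow> initial_ideal \<tau> (gl_act g ` ?F) = J"
      and g0: "\<exists>p\<in>P. eval_poly id (entries g0) p \<noteq> 0"
      unfolding zariski_open_GL_def by blast
    then obtain p where p: "p \<in> P" "eval_poly id (entries g0) p \<noteq> 0" by blast
    \<comment> \<open>A matrix at which both \<open>J\<close> and the initial ideal of \<open>F\<close> are attained.\<close>
    obtain g where g: "eval_poly id (entries g) p \<noteq> 0" "eval_poly id (entries g) ?p \<noteq> 0"
      using nonzeros_intersect[OF p(2) eval_minors_product_mat_1] by blast
    then have "g \<in> GL" using invertible_if_eval_minors_product by (simp add: GL_def)
    then show "J = initial_ideal \<tau> ?F" using J[OF _ p(1) g(1)] generic[OF g(2)] by simp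
  qed
qed

end
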